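(* Let $G$ be a $(k_G,t_G)$-star colorable graph and $H$ a $(k_H,t_H)$-star colorable graph, where $t_G\geq \chi(H)$ and $t_H\geq\chi(G)$. Then $G\square H$ is $(k_G+k_H,\min\{t_G,t_H\})$-star colorable.
   Context: All graphs are finite, simple and undirected. A star edge coloring of a graph is a proper edge coloring such that no path or cycle with four edges uses at most two colors. $\chi$ denotes the chromatic number. For an edge coloring $f$ and a vertex $v$, $A_f(v)$ denotes the set of colors of edges incident to $v$. Two star edge colorings $f_1,f_2$ of $G$ are star compatible if $A_{f_1}(v)\cap A_{f_2}(v)=\emptyset$ for every vertex $v$. $G$ is $(k,t)$-star colorable if $G$ has $t$ pairwise star compatible star edge colorings $f_i:E(G)\to\{0,1,\ldots,k-1\}$, $1\le i\le t$. The Cartesian product $G\square H$ has vertex set $V(G)\times V(H)$, with $(a,x)(b,y)$ an edge iff either $ab\in E(G)$ and $x=y$, or $xy\in E(H)$ and $a=b$. *)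

theory Defs
  imports Main
begin

record 'a ugraph =
  verts :: "'a set"
  edges :: "'a set set"

definition simple_graph :: "'a ugraph \<Rightarrow> bool" where
  "simple_graph G \<longleftrightarrow>
     finite (verts G) \<and> (\<forall>e\<in>edges G. e \<subseteq> verts G \<and> card e = 2)"

definition proper_vertex_coloring :: "'a ugraph \<Rightarrow> nat \<Rightarrow> ('a \<Rightarrow> nat) \<Rightarrow> bool" where
  "proper_vertex_coloring G k c \<longleftrightarrow>
     c ` verts G \<subseteq> {..<k} \<and> (\<forall>u v. {u, v} \<in> edges G \<longrightarrow> c u \<noteq> c v)"

definition chromatic_number :: "'a ugraph \<Rightarrow> nat" where
  "chromatic_number G = (LEAST k. \<exists>c. proper_vertex_coloring G k c)"

definition proper_edge_coloring :: "'a ugraph \<Rightarrow> ('a set \<Rightarrow> nat) \<Rightarrow> bool" where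
  "proper_edge_coloring G f \<longleftrightarrow>
     (\<forall>e1\<in>edges G. \<forall>e2\<in>edges G. e1 \<noteq> e2 \<and> e1 \<inter> e2 \<noteq> {} \<longrightarrow> f e1 \<noteq> f e2)"

definition walk_edges :: "'a list \<Rightarrow> 'a set list" where
  "walk_edges vs = map (\<lambda>(u, v). {u, v}) (zip vs (tl vs))"

definition is_path :: "'a ugraph \<Rightarrow> 'a list \<Rightarrow> bool" where
  "is_path G vs \<longleftrightarrow>
     vs \<noteq> [] \<and> distinct vs \<and> set vs \<subseteq> verts G \<and> set (walk_edges vs) \<subseteq> edges G"

text \<open>A cycle is given as a closed walk, its first vertex being repeated at the end.\<close>

definition is_cycle :: "'a ugraph \<Rightarrow> 'a list \<Rightarrow> bool" where
  "is_cycle G vs \<longleftrightarrow>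
     length vs \<ge> 4 \<and> hd vs = last vs \<and> distinct (tl vs) \<and>
     set vs \<subseteq> verts G \<and> set (walk_edges vs) \<subseteq> edges G"

definition star_edge_coloring :: "'a ugraph \<Rightarrow> ('a set \<Rightarrow> nat) \<Rightarrow> bool" where
  "star_edge_coloring G f \<longleftrightarrow>
     proper_edge_coloring G f \<and>
     \<not> (\<exists>vs. (is_path G vs \<or> is_cycle G vs) \<and> length (walk_edges vs) = 4 \<and>
            card (f ` set (walk_edges vs)) \<le> 2)"

definition colors_at :: "'a ugraph \<Rightarrow> ('a set \<Rightarrow> nat) \<Rightarrow> 'a \<Rightarrow> nat set" where
  "colors_at G f v = f ` {e \<in> edges G. v \<in> e}"

definition star_compatible :: "'a ugraph \<Rightarrow> ('a set \<Rightarrow> nat) \<Rightarrow> ('a set \<Rightarrow> nat) \<Rightarrow> bool" where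
  "star_compatible G f1 f2 \<longleftrightarrow> (\<forall>v\<in>verts G. colors_at G f1 v \<inter> colors_at G f2 v = {})"

text \<open>The colorings form an indexed family: on an edgeless graph all of its members coincide.\<close>

definition star_colorable :: "'a ugraph \<Rightarrow> nat \<Rightarrow> nat \<Rightarrow> bool" where
  "star_colorable G k t \<longleftrightarrow>
     (\<exists>f :: nat \<Rightarrow> 'a set \<Rightarrow> nat.
        (\<forall>i\<in>{1..t}. star_edge_coloring G (f i) \<and> f i ` edges G \<subseteq> {..<k}) \<and>
        (\<forall>i\<in>{1..t}. \<forall>j\<in>{1..t}. i \<noteq> j \<longrightarrow> star_compatible G (f i) (f j)))"

definition cartesian_product :: "'a ugraph \<Rightarrow> 'b ugraph \<Rightarrow> ('a \<times> 'b) ugraph" where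
  "cartesian_product G H =
     \<lparr> verts = verts G \<times> verts H,
       edges = {{(a, x), (b, y)} | a b x y.
                  a \<in> verts G \<and> b \<in> verts G \<and> x \<in> verts H \<and> y \<in> verts H \<and>
                  ({a, b} \<in> edges G \<and> x = y \<or> {x, y} \<in> edges H \<and> a = b)} \<rparr>"

lemma simple_graph_cartesian_product:
  assumes "simple_graph G" "simple_graph H"
  shows "simple_graph (cartesian_product G H)"
proof -
  have G: "a \<noteq> b" if "{a, b} \<in> edges G" for a b
    using that assms(1) unfolding simple_graph_def by force
  have H: "x \<noteq> y" if "{x, y} \<in> edges H" for x y
    using that assms(2) unfolding simple_graph_def by force
  have "e \<subseteq> verts (cartesian_product G H) \<and> card e = 2"
    if e: "e \<in> edges (cartesian_product G H)" for e
  proof -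
    obtain a b x y where e: "e = {(a, x), (b, y)}"
      and V: "a \<in> verts G" "b \<in> verts G" "x \<in> verts H" "y \<in> verts H"
      and E: "{a, b} \<in> edges G \<and> x = y \<or> {x, y} \<in> edges H \<and> a = b"
      using e by (simp add: cartesian_product_def) blast
    have "(a, x) \<noteq> (b, y)"
      using E G[of a b] H[of x y] by simp argo
    then show ?thesis
      using e V by (simp add: cartesian_product_def)
  qed
  moreover have "finite (verts (cartesian_product G H))"
    using assms by (simp add: simple_graph_def cartesian_product_def)
  ultimately show ?thesis
    by (simp add: simple_graph_def)
qed

lemma chromatic_number_attained:
  assumes "simple_graph G"
  shows "\<exists>c. proper_vertex_coloring G (chromatic_number G) c"
proof -
  have fin: "finite (verts G)"
    using assms by (simp add: simple_graph_def)
  obtain c :: "'a \<Rightarrow> nat" where c: "c ` verts G = {..<card (verts G)}" "inj_on c (verts G)"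
    using ex_bij_betw_finite_nat[OF fin] by (auto simp: bij_betw_def atLeast0LessThan)
  have "c u \<noteq> c v" if "{u, v} \<in> edges G" for u v
  proof -
    have "u \<in> verts G" "v \<in> verts G" "u \<noteq> v"
      using that assms unfolding simple_graph_def by force+
    then show ?thesis using c(2) by (auto dest: inj_onD)
  qed
  then have "proper_vertex_coloring G (card (verts G)) c"
    using c(1) by (simp add: proper_vertex_coloring_def)
  then have "\<exists>k c. proper_vertex_coloring G k c"
    by blast
  then show ?thesis
    unfolding chromatic_number_def by (rule LeastI_ex)
qed

end

theory Submission
  imports Defs
begin

text \<open>
  Color the \<open>G\<close>-fibre over a vertex \<open>x\<close> of \<open>H\<close> by one of the given colorings of \<open>G\<close>, chosen so
  that adjacent \<open>x\<close> and \<open>y\<close> get compatible ones; a proper vertex coloring of \<open>H\<close> supplies the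
  choice. Treat the \<open>H\<close>-fibres likewise, with a disjoint palette. If a bicolored walk with four
  edges used both kinds of edges, then three consecutive edges would be of alternating kind, the
  first and the last one having the same color; but they lie in adjacent fibres and meet a common
  vertex of the factor, against compatibility. Hence the walk lies in one fibre, where
  the coloring is a star edge coloring. Cyclically shifting the choice of colorings yields
  the compatible family.
\<close>

section \<open>Edges and proper edge colorings of simple graphs\<close>

lemma simple_graph_edgeD:
  assumes "simple_graph G" "{u, v} \<in> edges G"
  shows "u \<in> verts G" "v \<in> verts G" "u \<noteq> v"
  using assms unfolding simple_graph_def by force+

lemma simple_graph_edgeE:
  assumes "simple_graph G" "e \<in> edges G"
  obtains u v where "e = {u, v}" "u \<noteq> v"
  using assms unfolding simple_graph_def by (metis card_2_iff)

lemma proper_edge_coloringD: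
  assumes "proper_edge_coloring G f" "{u, v} \<in> edges G" "{u, w} \<in> edges G" "v \<noteq> w"
  shows "f {u, v} \<noteq> f {u, w}"
proof -
  have "{u, v} \<noteq> {u, w}" "{u, v} \<inter> {u, w} \<noteq> {}"
    using assms(4) by (auto simp: doubleton_eq_iff)
  then show ?thesis
    using assms(1)[unfolded proper_edge_coloring_def, rule_format, OF assms(2,3)] by simp
qed

lemma proper_edge_coloringI:
  assumes "simple_graph G"
    and "\<And>u v w. \<lbrakk>{u, v} \<in> edges G; {u, w} \<in> edges G; v \<noteq> w\<rbrakk> \<Longrightarrow> f {u, v} \<noteq> f {u, w}"
  shows "proper_edge_coloring G f"
  unfolding proper_edge_coloring_def
proof (intro ballI impI)
  fix d e assume d: "d \<in> edges G" and e: "e \<in> edges G" and de: "d \<noteq> e \<and> d \<inter> e \<noteq> {}"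
  then obtain u where u: "u \<in> d" "u \<in> e" by blast
  obtain v where v: "d = {u, v}"
    using simple_graph_edgeE[OF assms(1) d] u(1) by (metis insert_iff insert_commute singletonD)
  obtain w where w: "e = {u, w}"
    using simple_graph_edgeE[OF assms(1) e] u(2) by (metis insert_iff insert_commute singletonD)
  show "f d \<noteq> f e"
    using assms(2)[of u v w] d e de v w by blast
qed

section \<open>Bicolored walks with four edges\<close>

text \<open>Both \<open>a\<close> and \<open>c\<close> differ from \<open>b\<close>, so with only
  two values available they agree; \<open>b\<close> and \<open>d\<close> agree since both differ
  from \<open>c\<close>.\<close>

lemma alternating_if_card_le_2:
  assumes "card {a, b, c, d} \<le> 2" "a \<noteq> b" "b \<noteq> c" "c \<noteq> d"
  shows "a = c \<and> b = d"
  using assms by (auto simp: card_insert_if split: if_splits)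

text \<open>The case \<open>v0 = v4\<close> is the four-cycle; \<open>v0 \<noteq> v3\<close> and \<open>v1 \<noteq> v4\<close> are forced by properness.\<close>

lemma star_edge_coloring_iff:
  assumes G: "simple_graph G"
  shows "star_edge_coloring G f \<longleftrightarrow> proper_edge_coloring G f \<and>
    (\<forall>v0 v1 v2 v3 v4. {v0, v1} \<in> edges G \<and> {v1, v2} \<in> edges G \<and> {v2, v3} \<in> edges G \<and>
       {v3, v4} \<in> edges G \<and> v0 \<noteq> v2 \<and> v1 \<noteq> v3 \<and> v2 \<noteq> v4 \<longrightarrow>
       \<not> (f {v0, v1} = f {v2, v3} \<and> f {v1, v2} = f {v3, v4}))"
    (is "_ \<longleftrightarrow> _ \<and> ?alt")
proof (intro iffI conjI)
  assume star: "star_edge_coloring G f"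
  then show proper: "proper_edge_coloring G f"
    by (simp add: star_edge_coloring_def)
  show ?alt
  proof (intro allI impI notI, elim conjE)
    fix v0 v1 v2 v3 v4
    assume e: "{v0, v1} \<in> edges G" "{v1, v2} \<in> edges G" "{v2, v3} \<in> edges G" "{v3, v4} \<in> edges G"
      and ne: "v0 \<noteq> v2" "v1 \<noteq> v3" "v2 \<noteq> v4"
      and c: "f {v0, v1} = f {v2, v3}" "f {v1, v2} = f {v3, v4}"
    let ?vs = "[v0, v1, v2, v3, v4]"
    have near: "v0 \<noteq> v1" "v1 \<noteq> v2" "v2 \<noteq> v3" "v3 \<noteq> v4"
      using e simple_graph_edgeD(3)[OF G] by blast+
    \<comment> \<open>If \<open>v0 = v3\<close>, the equally colored first and third edges would
      meet there; if \<open>v1 = v4\<close>, the second and fourth would.\<close>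
    have far: "v0 \<noteq> v3" "v1 \<noteq> v4"
      using proper_edge_coloringD[OF proper, of v0 v1 v2] proper_edge_coloringD[OF proper, of v1 v2 v3]
        e ne near c by (auto simp: insert_commute)
    have verts: "set ?vs \<subseteq> verts G"
      using e simple_graph_edgeD(1,2)[OF G] by auto
    have edges: "walk_edges ?vs = [{v0, v1}, {v1, v2}, {v2, v3}, {v3, v4}]"
      by (simp add: walk_edges_def)
    have "is_path G ?vs \<or> is_cycle G ?vs"
      using e ne far near verts edges by (auto simp: is_path_def is_cycle_def)
    moreover have "card (f ` set (walk_edges ?vs)) \<le> 2"
      using edges c by (simp add: card_insert_if)
    moreover have "length (walk_edges ?vs) = 4"
      using edges by simp
    ultimately show False
      using star unfolding star_edge_coloring_def by blast
  qed
next
  assume "proper_edge_coloring G f \<and> ?alt"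
  then have proper: "proper_edge_coloring G f" and alt: ?alt by blast+
  have False
    if vs: "is_path G vs \<or> is_cycle G vs" "length (walk_edges vs) = 4"
      "card (f ` set (walk_edges vs)) \<le> 2" for vs
  proof -
    have "length vs = 5"
      using vs(2) by (cases vs) (auto simp: walk_edges_def)
    then obtain v0 v1 v2 v3 v4 where v: "vs = [v0, v1, v2, v3, v4]"
      by (auto simp: numeral_eq_Suc length_Suc_conv)
    \<comment> \<open>On a cycle only the tail is known to be distinct; there
      \<open>v0 \<noteq> v2\<close> comes from \<open>v0 = v4\<close>.\<close>
    have e: "{v0, v1} \<in> edges G" "{v1, v2} \<in> edges G" "{v2, v3} \<in> edges G" "{v3, v4} \<in> edges G"
      and ne: "v0 \<noteq> v2" "v1 \<noteq> v3" "v2 \<noteq> v4"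
      using vs(1) v by (auto simp: is_path_def is_cycle_def walk_edges_def)
    have "f {v0, v1} = f {v2, v3} \<and> f {v1, v2} = f {v3, v4}"
    proof (rule alternating_if_card_le_2)
      show "card {f {v0, v1}, f {v1, v2}, f {v2, v3}, f {v3, v4}} \<le> 2"
        using vs(3) v by (simp add: walk_edges_def)
      show "f {v0, v1} \<noteq> f {v1, v2}" "f {v1, v2} \<noteq> f {v2, v3}" "f {v2, v3} \<noteq> f {v3, v4}"
        using proper_edge_coloringD[OF proper, of v1 v0 v2] proper_edge_coloringD[OF proper, of v2 v1 v3]
          proper_edge_coloringD[OF proper, of v3 v2 v4] e ne by (simp_all add: insert_commute)
    qed
    with alt e ne show False by blast
  qed
  with proper show "star_edge_coloring G f"
    unfolding star_edge_coloring_def by blast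
qed

section \<open>Star compatibility in terms of edges at a common vertex\<close>

text \<open>The two edges may coincide (\<open>v = w\<close>), as happens when three consecutive
  edges of a walk run along a square of the product: the outer two then project to the same
  edge.\<close>

lemma star_compatibleD:
  assumes "star_compatible G f g" "simple_graph G" "{u, v} \<in> edges G" "{u, w} \<in> edges G"
  shows "f {u, v} \<noteq> g {u, w}"
proof -
  have "u \<in> verts G"
    using simple_graph_edgeD(1)[OF assms(2,3)] .
  moreover have "f {u, v} \<in> colors_at G f u" "g {u, w} \<in> colors_at G g u"
    using assms(3,4) by (auto simp: colors_at_def)
  ultimately show ?thesis
    using assms(1) unfolding star_compatible_def by (metis disjoint_iff)
qed

lemma star_compatibleI:
  assumes "simple_graph G"
    and "\<And>u v w. \<lbrakk>{u, v} \<in> edges G; {u, w} \<in> edges G\<rbrakk> \<Longrightarrow> f {u, v} \<noteq> g {u, w}"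
  shows "star_compatible G f g"
proof -
  have "f d \<noteq> g e" if d: "d \<in> edges G" "u \<in> d" and e: "e \<in> edges G" "u \<in> e" for u d e
  proof -
    obtain v where "d = {u, v}"
      using simple_graph_edgeE[OF assms(1) d(1)] d(2)
      by (metis insert_iff insert_commute singletonD)
    moreover obtain w where "e = {u, w}"
      using simple_graph_edgeE[OF assms(1) e(1)] e(2)
      by (metis insert_iff insert_commute singletonD)
    ultimately show ?thesis
      using assms(2)[of u v w] d e by blast
  qed
  then show ?thesis
    unfolding star_compatible_def colors_at_def by auto
qed

section \<open>Edges of the Cartesian product and their colors\<close>

lemma cartesian_product_edge_iff:
  assumes "simple_graph G" "simple_graph H"
  shows "{(a, x), (b, y)} \<in> edges (cartesian_product G H) \<longleftrightarrow>
    ({a, b} \<in> edges G \<and> x = y \<and> x \<in> verts H) \<or> ({x, y} \<in> edges H \<and> a = b \<and> a \<in> verts G)"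
    (is "_ = ?R")
proof
  assume "{(a, x), (b, y)} \<in> edges (cartesian_product G H)"
  then show ?R
    by (auto simp: cartesian_product_def doubleton_eq_iff insert_commute)
next
  assume ?R
  then show "{(a, x), (b, y)} \<in> edges (cartesian_product G H)"
    using simple_graph_edgeD(1,2)[OF assms(1)] simple_graph_edgeD(1,2)[OF assms(2)]
    unfolding cartesian_product_def by fastforce
qed

text \<open>An edge is a set without a preferred endpoint, so its fibre is read off from the
  projections: an edge along \<open>G\<close> is one with a single second coordinate. Adding
  \<open>k\<close> separates the palettes once every \<open>\<phi> x\<close> stays below
  \<open>k\<close>.\<close>

definition product_coloring ::
  "nat \<Rightarrow> ('b \<Rightarrow> 'a set \<Rightarrow> nat) \<Rightarrow> ('a \<Rightarrow> 'b set \<Rightarrow> nat) \<Rightarrow> ('a \<times> 'b) set \<Rightarrow> nat" where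
  "product_coloring k \<phi> \<psi> e =
     (if is_singleton (snd ` e) then \<phi> (the_elem (snd ` e)) (fst ` e)
      else k + \<psi> (the_elem (fst ` e)) (snd ` e))"

lemma product_coloring_left [simp]:
  "product_coloring k \<phi> \<psi> {(a, x), (b, x)} = \<phi> x {a, b}"
  by (simp add: product_coloring_def)

lemma product_coloring_right:
  assumes "x \<noteq> y"
  shows "product_coloring k \<phi> \<psi> {(a, x), (a, y)} = k + \<psi> a {x, y}"
  using assms by (auto simp: product_coloring_def is_singleton_def)

text \<open>Comparing a color with \<open>k\<close> tells the kind of the edge. The cases record
  this, so that linear arithmetic rules out equal colors on edges of different kinds.\<close>

lemma product_edge_cases:
  assumes "simple_graph G" "simple_graph H"
    and "{p, q} \<in> edges (cartesian_product G H)"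
    and "\<forall>x\<in>verts H. \<phi> x ` edges G \<subseteq> {..<k}"
  obtains (left) "snd p = snd q" "snd p \<in> verts H" "{fst p, fst q} \<in> edges G"
      "product_coloring k \<phi> \<psi> {p, q} = \<phi> (snd p) {fst p, fst q}"
      "product_coloring k \<phi> \<psi> {p, q} < k"
    | (right) "fst p = fst q" "fst p \<in> verts G" "{snd p, snd q} \<in> edges H"
      "product_coloring k \<phi> \<psi> {p, q} = k + \<psi> (fst p) {snd p, snd q}"
      "k \<le> product_coloring k \<phi> \<psi> {p, q}"
proof -
  obtain a x b y where pq: "p = (a, x)" "q = (b, y)"
    by (metis surj_pair)
  from assms(3) consider "{a, b} \<in> edges G" "x = y" "x \<in> verts H"
    | "{x, y} \<in> edges H" "a = b" "a \<in> verts G"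
    using cartesian_product_edge_iff[OF assms(1,2)] pq by blast
  then show thesis
  proof cases
    case 1
    then have "\<phi> x {a, b} < k"
      using assms(4) by blast
    with 1 pq show thesis
      by (intro left) auto
  next
    case 2
    then have "x \<noteq> y"
      using simple_graph_edgeD(3)[OF assms(2)] by blast
    with 2 pq show thesis
      by (intro right) (auto simp: product_coloring_right)
  qed
qed

section \<open>Star property, compatibility and palette of the product coloring\<close>

text \<open>In an alternately colored walk the first and third edges are of one kind, and so are the
  second and fourth. Hence either all four lie in one fibre, or the kinds alternate and the first
  three already contradict compatibility.\<close>

lemma star_edge_coloring_product:
  assumes G: "simple_graph G" and H: "simple_graph H"
    and star_\<phi>: "\<And>x. x \<in> verts H \<Longrightarrow> star_edge_coloring G (\<phi> x)"
    and bound_\<phi>: "\<forall>x\<in>verts H. \<phi> x ` edges G \<subseteq> {..<k}"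
    and comp_\<phi>: "\<And>x y. {x, y} \<in> edges H \<Longrightarrow> star_compatible G (\<phi> x) (\<phi> y)"
    and star_\<psi>: "\<And>a. a \<in> verts G \<Longrightarrow> star_edge_coloring H (\<psi> a)"
    and comp_\<psi>: "\<And>a b. {a, b} \<in> edges G \<Longrightarrow> star_compatible H (\<psi> a) (\<psi> b)"
  shows "star_edge_coloring (cartesian_product G H) (product_coloring k \<phi> \<psi>)"
proof -
  let ?P = "cartesian_product G H" and ?F = "product_coloring k \<phi> \<psi>"
  have P: "simple_graph ?P"
    using simple_graph_cartesian_product[OF G H] .
  have prop_\<phi>: "proper_edge_coloring G (\<phi> x)" if "x \<in> verts H" for x
    using star_\<phi>[OF that] by (simp add: star_edge_coloring_def)
  have prop_\<psi>: "proper_edge_coloring H (\<psi> a)" if "a \<in> verts G" for a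
    using star_\<psi>[OF that] by (simp add: star_edge_coloring_def)
  note edge_cases = product_edge_cases[OF G H _ bound_\<phi>, where \<psi> = \<psi>, consumes 1,
      case_names left right]
  have "proper_edge_coloring ?P ?F"
  proof (rule proper_edge_coloringI[OF P])
    fix p q r assume pq: "{p, q} \<in> edges ?P" and pr: "{p, r} \<in> edges ?P" and "q \<noteq> r"
    show "?F {p, q} \<noteq> ?F {p, r}"
      using pq
    proof (cases rule: edge_cases)
      case 1: left
      show ?thesis
        using pr
      proof (cases rule: edge_cases)
        case left
        with 1 \<open>q \<noteq> r\<close> have "fst q \<noteq> fst r"
          by (metis prod_eqI)
        then show ?thesis
          using proper_edge_coloringD[OF prop_\<phi>[OF 1(2)] 1(3) left(3)] 1(4) left(4) by simp
      qed (use 1 in linarith)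
    next
      case 1: right
      show ?thesis
        using pr
      proof (cases rule: edge_cases)
        case right
        with 1 \<open>q \<noteq> r\<close> have "snd q \<noteq> snd r"
          by (metis prod_eqI)
        then show ?thesis
          using proper_edge_coloringD[OF prop_\<psi>[OF 1(2)] 1(3) right(3)] 1(4) right(4) by simp
      qed (use 1 in linarith)
    qed
  qed
  moreover have "\<not> (?F {v0, v1} = ?F {v2, v3} \<and> ?F {v1, v2} = ?F {v3, v4})"
    if e: "{v0, v1} \<in> edges ?P" "{v1, v2} \<in> edges ?P" "{v2, v3} \<in> edges ?P" "{v3, v4} \<in> edges ?P"
      and ne: "v0 \<noteq> v2" "v1 \<noteq> v3" "v2 \<noteq> v4" for v0 v1 v2 v3 v4
  proof
    assume c: "?F {v0, v1} = ?F {v2, v3} \<and> ?F {v1, v2} = ?F {v3, v4}"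
    show False
      using e(1)
    proof (cases rule: edge_cases)
      case e1: left
      \<comment> \<open>The third edge has the color of the first, hence a color below
        \<open>k\<close>, and so it also runs along \<open>G\<close>.\<close>
      have e3: "snd v2 = snd v3" "{fst v2, fst v3} \<in> edges G"
        "?F {v2, v3} = \<phi> (snd v2) {fst v2, fst v3}"
        by (cases rule: edge_cases[OF e(3)]; (assumption | use c e1(5) in linarith))+
      show False
        using e(2)
      proof (cases rule: edge_cases)
        case e2: left
        have e4: "snd v3 = snd v4" "{fst v3, fst v4} \<in> edges G"
          "?F {v3, v4} = \<phi> (snd v3) {fst v3, fst v4}"
          by (cases rule: edge_cases[OF e(4)]; (assumption | use c e2(5) in linarith))+
        \<comment> \<open>The second coordinate is constant along the walk, so distinct vertices
          differ in the first one.\<close>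
        have ne': "fst v0 \<noteq> fst v2" "fst v1 \<noteq> fst v3" "fst v2 \<noteq> fst v4"
          using ne e1(1) e2(1) e3(1) e4(1) by (metis prod_eqI)+
        have "\<phi> (snd v0) {fst v0, fst v1} = \<phi> (snd v0) {fst v2, fst v3}"
          "\<phi> (snd v0) {fst v1, fst v2} = \<phi> (snd v0) {fst v3, fst v4}"
          using c e1(1,4) e2(1,4) e3(1,3) e4(1,3) by simp_all
        then show False
          using star_\<phi>[OF e1(2)] e1(3) e2(3) e3(2) e4(2) ne'
          unfolding star_edge_coloring_iff[OF G] by blast
      next
        case e2: right
        \<comment> \<open>The middle edge keeps the first coordinate, so its neighbors on the walk
          project to edges of \<open>G\<close> at \<open>fst v1\<close>. They are colored by
          \<open>\<phi>\<close> at the adjacent vertices \<open>snd v1\<close> and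
          \<open>snd v2\<close> of \<open>H\<close>.\<close>
        have "\<phi> (snd v1) {fst v1, fst v0} = \<phi> (snd v2) {fst v1, fst v3}"
          using c e1(1,4) e2(1) e3(3) by (simp add: insert_commute)
        moreover have "{fst v1, fst v0} \<in> edges G" "{fst v1, fst v3} \<in> edges G"
          using e1(3) e2(1) e3(2) by (simp_all add: insert_commute)
        ultimately show False
          using star_compatibleD[OF comp_\<phi>[OF e2(3)] G] by blast
      qed
    next
      \<comment> \<open>The same argument with the factors exchanged; colors of at least
        \<open>k\<close> now identify edges along \<open>H\<close>.\<close>
      case e1: right
      have e3: "fst v2 = fst v3" "{snd v2, snd v3} \<in> edges H"
        "?F {v2, v3} = k + \<psi> (fst v2) {snd v2, snd v3}"
        by (cases rule: edge_cases[OF e(3)]; (assumption | use c e1(5) in linarith))+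
      show False
        using e(2)
      proof (cases rule: edge_cases)
        case e2: right
        have e4: "fst v3 = fst v4" "{snd v3, snd v4} \<in> edges H"
          "?F {v3, v4} = k + \<psi> (fst v3) {snd v3, snd v4}"
          by (cases rule: edge_cases[OF e(4)]; (assumption | use c e2(5) in linarith))+
        have ne': "snd v0 \<noteq> snd v2" "snd v1 \<noteq> snd v3" "snd v2 \<noteq> snd v4"
          using ne e1(1) e2(1) e3(1) e4(1) by (metis prod_eqI)+
        have "\<psi> (fst v0) {snd v0, snd v1} = \<psi> (fst v0) {snd v2, snd v3}"
          "\<psi> (fst v0) {snd v1, snd v2} = \<psi> (fst v0) {snd v3, snd v4}"
          using c e1(1,4) e2(1,4) e3(1,3) e4(1,3) by simp_all
        then show False
          using star_\<psi>[OF e1(2)] e1(3) e2(3) e3(2) e4(2) ne'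
          unfolding star_edge_coloring_iff[OF H] by blast
      next
        case e2: left
        have "\<psi> (fst v1) {snd v1, snd v0} = \<psi> (fst v2) {snd v1, snd v3}"
          using c e1(1,4) e2(1) e3(3) by (simp add: insert_commute)
        moreover have "{snd v1, snd v0} \<in> edges H" "{snd v1, snd v3} \<in> edges H"
          using e1(3) e2(1) e3(2) by (simp_all add: insert_commute)
        ultimately show False
          using star_compatibleD[OF comp_\<psi>[OF e2(3)] H] by blast
      qed
    qed
  qed
  ultimately show ?thesis
    unfolding star_edge_coloring_iff[OF P] by blast
qed

text \<open>Edges of different kinds are separated by the common threshold \<open>k\<close>. Edges
  of the same kind at a common vertex lie in one fibre, where compatibility of the two factor
  colorings applies.\<close>

lemma star_compatible_product:
  assumes G: "simple_graph G" and H: "simple_graph H"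
    and bound: "\<forall>x\<in>verts H. \<phi> x ` edges G \<subseteq> {..<k}"
      "\<forall>x\<in>verts H. \<phi>' x ` edges G \<subseteq> {..<k}"
    and comp_\<phi>: "\<And>x. x \<in> verts H \<Longrightarrow> star_compatible G (\<phi> x) (\<phi>' x)"
    and comp_\<psi>: "\<And>a. a \<in> verts G \<Longrightarrow> star_compatible H (\<psi> a) (\<psi>' a)"
  shows "star_compatible (cartesian_product G H) (product_coloring k \<phi> \<psi>) (product_coloring k \<phi>' \<psi>')"
proof (rule star_compatibleI[OF simple_graph_cartesian_product[OF G H]])
  fix p q r
  assume pq: "{p, q} \<in> edges (cartesian_product G H)" and pr: "{p, r} \<in> edges (cartesian_product G H)"
  note cases1 = product_edge_cases[OF G H pq bound(1), where \<psi> = \<psi>, case_names left right]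
  note cases2 = product_edge_cases[OF G H pr bound(2), where \<psi> = \<psi>', case_names left right]
  show "product_coloring k \<phi> \<psi> {p, q} \<noteq> product_coloring k \<phi>' \<psi>' {p, r}"
  proof (cases rule: cases1)
    case 1: left
    show ?thesis
    proof (cases rule: cases2)
      case left
      with 1 show ?thesis
        using star_compatibleD[OF comp_\<phi> G] by metis
    qed (use 1 in linarith)
  next
    case 1: right
    show ?thesis
    proof (cases rule: cases2)
      case right
      with 1 show ?thesis
        using star_compatibleD[OF comp_\<psi> H] by (metis add_left_cancel)
    qed (use 1 in linarith)
  qed
qed

lemma product_coloring_bound:
  assumes "simple_graph G" "simple_graph H"
    and "\<forall>x\<in>verts H. \<phi> x ` edges G \<subseteq> {..<k}"
    and "\<forall>a\<in>verts G. \<psi> a ` edges H \<subseteq> {..<l}"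
  shows "product_coloring k \<phi> \<psi> ` edges (cartesian_product G H) \<subseteq> {..<k + l}"
proof (rule image_subsetI)
  fix e assume e: "e \<in> edges (cartesian_product G H)"
  then obtain p q where pq: "e = {p, q}"
    using simple_graph_edgeE simple_graph_cartesian_product[OF assms(1,2)] by metis
  have "product_coloring k \<phi> \<psi> {p, q} < k + l"
  proof (cases rule: product_edge_cases[OF assms(1,2) e[unfolded pq] assms(3),
      where \<psi> = \<psi>, case_names left right])
    case right
    then have "\<psi> (fst p) {snd p, snd q} < l"
      using assms(4) by blast
    with right show ?thesis by simp
  qed simp
  then show "product_coloring k \<phi> \<psi> e \<in> {..<k + l}"
    by (simp add: pq)
qed

section \<open>Cyclic shifts of the choice of colorings\<close>

text \<open>Here \<open>i\<close> is the shift and \<open>c\<close> a vertex color. The final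
  \<open>+ 1\<close> moves residues into \<open>{1..t}\<close>, the index set of
  \<open>star_colorable\<close>.\<close>

definition cyclic_index :: "nat \<Rightarrow> nat \<Rightarrow> nat \<Rightarrow> nat" where
  "cyclic_index t i c = (i + c) mod t + 1"

lemma cyclic_index_in: "0 < t \<Longrightarrow> cyclic_index t i c \<in> {1..t}"
  by (simp add: cyclic_index_def Suc_leI)

lemma mod_add_left_inj:
  fixes i c d t :: nat
  assumes "(i + c) mod t = (i + d) mod t" "c < t" "d < t"
  shows "c = d"
proof -
  \<comment> \<open>Subtraction on \<open>nat\<close> truncates; over the integers the common
    summand \<open>i\<close> cancels.\<close>
  have "int t dvd int (i + c) - int (i + d)"
    using assms(1) by (metis mod_eq_dvd_iff of_nat_mod)
  then have "int t dvd int c - int d" by simp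
  then have "int c mod int t = int d mod int t"
    by (simp add: mod_eq_dvd_iff)
  then show ?thesis using assms(2,3) by simp
qed

text \<open>Within one member of the family, adjacent vertices of one factor thereby select
  different, hence compatible, colorings of the other.\<close>

lemma cyclic_index_neq_color:
  assumes "c < t" "d < t" "c \<noteq> d"
  shows "cyclic_index t i c \<noteq> cyclic_index t i d"
  using mod_add_left_inj[of i c t d] assms by (auto simp: cyclic_index_def)

text \<open>This compares two members of the family: on any given fibre they use different colorings
  of the factor.\<close>

lemma cyclic_index_neq_shift:
  assumes "i \<in> {1..t}" "j \<in> {1..t}" "i \<noteq> j"
  shows "cyclic_index t i c \<noteq> cyclic_index t j c"
proof -
  \<comment> \<open>The shift \<open>i\<close> may equal \<open>t\<close>. Moving a unit into the
    common summand leaves \<open>i - 1\<close> and \<open>j - 1\<close>, which are below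
    \<open>t\<close> as cancellation requires.\<close>
  have "(c + 1 + (i - 1)) mod t \<noteq> (c + 1 + (j - 1)) mod t"
    using mod_add_left_inj[of "c + 1" "i - 1" t "j - 1"] assms by fastforce
  then show ?thesis
    using assms by (simp add: cyclic_index_def add.commute)
qed

section \<open>Vertex colorings as selectors, and the resulting family\<close>

lemma proper_vertex_coloringD:
  assumes "proper_vertex_coloring G k c" "simple_graph G" "{u, v} \<in> edges G"
  shows "c u < k" "c v < k" "c u \<noteq> c v"
  using assms(1,3) simple_graph_edgeD(1,2)[OF assms(2,3)]
  by (auto simp: proper_vertex_coloring_def)

lemma proper_vertex_coloring_mono:
  assumes "proper_vertex_coloring G k c" "k \<le> t"
  shows "proper_vertex_coloring G t c"
  using assms by (fastforce simp: proper_vertex_coloring_def)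

theorem theorem3:
  fixes G :: "'a ugraph" and H :: "'b ugraph"
    and k_G t_G k_H t_H :: nat
  assumes "simple_graph G" and "simple_graph H"
    and "star_colorable G k_G t_G" and "star_colorable H k_H t_H"
    and "t_G \<ge> chromatic_number H" and "t_H \<ge> chromatic_number G"
  shows "star_colorable (cartesian_product G H) (k_G + k_H) (min t_G t_H)"
proof -
  note G = assms(1) and H = assms(2)
  obtain f where f': "\<forall>i\<in>{1..t_G}. star_edge_coloring G (f i) \<and> f i ` edges G \<subseteq> {..<k_G}"
      and f3: "\<forall>i\<in>{1..t_G}. \<forall>j\<in>{1..t_G}. i \<noteq> j \<longrightarrow> star_compatible G (f i) (f j)"
    using assms(3) unfolding star_colorable_def by (elim exE conjE)
  have f1: "star_edge_coloring G (f i)" and f2: "f i ` edges G \<subseteq> {..<k_G}" if "i \<in> {1..t_G}" for i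
    using f' that by blast+
  obtain g where g': "\<forall>i\<in>{1..t_H}. star_edge_coloring H (g i) \<and> g i ` edges H \<subseteq> {..<k_H}"
      and g3: "\<forall>i\<in>{1..t_H}. \<forall>j\<in>{1..t_H}. i \<noteq> j \<longrightarrow> star_compatible H (g i) (g j)"
    using assms(4) unfolding star_colorable_def by (elim exE conjE)
  have g1: "star_edge_coloring H (g i)" and g2: "g i ` edges H \<subseteq> {..<k_H}" if "i \<in> {1..t_H}" for i
    using g' that by blast+
  \<comment> \<open>Vertices of \<open>G\<close> select among the \<open>t_H\<close> colorings of
    \<open>H\<close> and conversely, so the palette sizes are crossed; the bounds on the chromatic
    numbers make room for proper colorings.\<close>
  obtain cG where cG: "proper_vertex_coloring G t_H cG"
    using chromatic_number_attained[OF G] proper_vertex_coloring_mono assms(6) by blast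
  obtain cH where cH: "proper_vertex_coloring H t_G cH"
    using chromatic_number_attained[OF H] proper_vertex_coloring_mono assms(5) by blast
  define \<phi> where "\<phi> i x = f (cyclic_index t_G i (cH x))" for i x
  define \<psi> where "\<psi> i a = g (cyclic_index t_H i (cG a))" for i a
  define F where "F i = product_coloring k_G (\<phi> i) (\<psi> i)" for i
  \<comment> \<open>Any index \<open>j\<close> of the family witnesses that \<open>t_G\<close> and
    \<open>t_H\<close> are positive, so that residues modulo them are valid indices.\<close>
  have in_G: "cyclic_index t_G i c \<in> {1..t_G}" and in_H: "cyclic_index t_H i c \<in> {1..t_H}"
    if "j \<in> {1..min t_G t_H}" for i j c
    using cyclic_index_in[of t_G i c] cyclic_index_in[of t_H i c] that by auto
  have star_\<phi>: "star_edge_coloring G (\<phi> i x)" and bound_\<phi>: "\<phi> i x ` edges G \<subseteq> {..<k_G}"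
    if "i \<in> {1..min t_G t_H}" for i x
    unfolding \<phi>_def using f1 f2 in_G[OF that] by simp_all
  have star_\<psi>: "star_edge_coloring H (\<psi> i a)" and bound_\<psi>: "\<psi> i a ` edges H \<subseteq> {..<k_H}"
    if "i \<in> {1..min t_G t_H}" for i a
    unfolding \<psi>_def using g1 g2 in_H[OF that] by simp_all
  have comp_\<phi>: "star_compatible G (\<phi> i x) (\<phi> i y)"
    if "i \<in> {1..min t_G t_H}" "{x, y} \<in> edges H" for i x y
    unfolding \<phi>_def using f3 in_G[OF that(1)]
      cyclic_index_neq_color[OF proper_vertex_coloringD[OF cH H that(2)]] by simp
  have comp_\<psi>: "star_compatible H (\<psi> i a) (\<psi> i b)"
    if "i \<in> {1..min t_G t_H}" "{a, b} \<in> edges G" for i a b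
    unfolding \<psi>_def using g3 in_H[OF that(1)]
      cyclic_index_neq_color[OF proper_vertex_coloringD[OF cG G that(2)]] by simp
  have "star_edge_coloring (cartesian_product G H) (F i)" if i: "i \<in> {1..min t_G t_H}" for i
    unfolding F_def by (intro star_edge_coloring_product G H ballI
        star_\<phi>[OF i] bound_\<phi>[OF i] comp_\<phi>[OF i] star_\<psi>[OF i] comp_\<psi>[OF i])
  moreover have "F i ` edges (cartesian_product G H) \<subseteq> {..<k_G + k_H}"
    if i: "i \<in> {1..min t_G t_H}" for i
    unfolding F_def by (intro product_coloring_bound G H ballI
        bound_\<phi>[OF i] bound_\<psi>[OF i])
  moreover have "star_compatible (cartesian_product G H) (F i) (F j)"
    if i: "i \<in> {1..min t_G t_H}" and j: "j \<in> {1..min t_G t_H}" and "i \<noteq> j" for i j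
  proof -
    \<comment> \<open>Here the minimum matters: shifts up to it are distinct modulo both
      \<open>t_G\<close> and \<open>t_H\<close>.\<close>
    have "cyclic_index t_G i c \<noteq> cyclic_index t_G j c"
      "cyclic_index t_H i c \<noteq> cyclic_index t_H j c" for c
      using cyclic_index_neq_shift that by auto
    then have comp: "star_compatible G (\<phi> i x) (\<phi> j x)" "star_compatible H (\<psi> i a) (\<psi> j a)" for x a
      unfolding \<phi>_def \<psi>_def using f3 g3 in_G[OF i] in_H[OF i] by simp_all
    then show ?thesis
      unfolding F_def by (intro star_compatible_product G H ballI
          bound_\<phi>[OF i] bound_\<phi>[OF j] comp)
  qed
  ultimately show ?thesis
    unfolding star_colorable_def by (intro exI[of _ F]) simp
qed

end
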